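(* Let $C$ be non-decreasing and convex. For all slots $k\le l$, $$\overline{C}(k,l)=\max_{z\in[k,l]}\Bigg[C\Bigg(\sum_{j\in K^z_{k,l}}e_j\Bigg)+\overline{C}(k,z-1)+\overline{C}(z+1,l)\Bigg].$$
   Context: Total-energy model, full attack. Time is slotted with slots $1,\dots,T$; $[k,l]$ denotes the set of slots $\{k,\dots,l\}$. There are $n\ge1$ jobs $J=\{1,\dots,n\}$; job $j$ has demand $(a_j,d_j,e_j)$ with $a_j,d_j\in\{1,\dots,T\}$, $a_j\le d_j$, $e_j>0$; its job interval is $[a_j,d_j]$. The cost function $C:[0,\infty)\to[0,\infty)$ is non-decreasing and convex. In the full-attack maximization problem each job $j$ is served entirely (energy $e_j$) in a single slot $t_j\in[a_j,d_j]$ chosen by the attacker, and the cost is the sum over slots of $C$ of the total energy served in that slot. For $k\le l$ let $\mathcal I_J(k,l)=\{j\in J: a_j\ge k,\ d_j\le l\}$ be the set of jobs whose intervals are entirely contained in $[k,l]$. Let $\overline C(k,l)$ be the maximum cost achievable by solely scheduling the jobs in $\mathcal I_J(k,l)$, i.e. $$\overline C(k,l)=\max\Big\{\sum_{t=k}^{l}C\Big(\sum_{j\in\mathcal I_J(k,l):\,t_j=t}e_j\Big): t_j\in[a_j,d_j]\ \text{for all } j\in\mathcal I_J(k,l)\Big\},$$ with the convention $\overline C(k,l)=0$ if $k>l$. For $z\in[k,l]$, $K^z_{k,l}=\{j\in\mathcal I_J(k,l): a_j\le z\le d_j\}$ is the locally maximal clique at $z$ for the jobs restricted to $\mathcal I_J(k,l)$.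 An empty sum is $0$. *)

theory Defs
  imports "HOL-Analysis.Analysis"
begin

text \<open>
  Slots and jobs are natural numbers; a set \<open>J\<close> of jobs comes with arrivals \<open>a\<close>, deadlines \<open>d\<close>
  and energies \<open>e\<close>. Slots start at 1, so the truncated subtraction in \<open>z - 1\<close> is exact.
\<close>

definition contained_jobs :: "nat set \<Rightarrow> (nat \<Rightarrow> nat) \<Rightarrow> (nat \<Rightarrow> nat) \<Rightarrow> nat \<Rightarrow> nat \<Rightarrow> nat set"
  where "contained_jobs J a d k l = {j \<in> J. k \<le> a j \<and> d j \<le> l}"

definition schedules :: "nat set \<Rightarrow> (nat \<Rightarrow> nat) \<Rightarrow> (nat \<Rightarrow> nat) \<Rightarrow> (nat \<Rightarrow> nat) set"
  where "schedules I a d = (\<Pi>\<^sub>E j\<in>I. {a j..d j})"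

definition schedule_cost ::
  "(real \<Rightarrow> real) \<Rightarrow> nat set \<Rightarrow> (nat \<Rightarrow> real) \<Rightarrow> nat \<Rightarrow> nat \<Rightarrow> (nat \<Rightarrow> nat) \<Rightarrow> real"
  where "schedule_cost C I e k l s = (\<Sum>t=k..l. C (\<Sum>j\<in>{j \<in> I. s j = t}. e j))"

definition max_cost ::
  "(real \<Rightarrow> real) \<Rightarrow> nat set \<Rightarrow> (nat \<Rightarrow> nat) \<Rightarrow> (nat \<Rightarrow> nat) \<Rightarrow> (nat \<Rightarrow> real) \<Rightarrow> nat \<Rightarrow> nat \<Rightarrow> real"
  where "max_cost C J a d e k l =
    (if k > l then 0
     else Max (schedule_cost C (contained_jobs J a d k l) e k l `
                 schedules (contained_jobs J a d k l) a d))"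

definition local_clique ::
  "nat set \<Rightarrow> (nat \<Rightarrow> nat) \<Rightarrow> (nat \<Rightarrow> nat) \<Rightarrow> nat \<Rightarrow> nat \<Rightarrow> nat \<Rightarrow> nat set"
  where "local_clique J a d k l z = {j \<in> contained_jobs J a d k l. a j \<le> z \<and> z \<le> d j}"

text \<open>The maximum in \<open>max_cost\<close> is taken over a finite nonempty set.\<close>

lemma finite_schedules: "finite J \<Longrightarrow> finite (schedules (contained_jobs J a d k l) a d)"
  unfolding schedules_def contained_jobs_def by (intro finite_PiE) auto

lemma schedules_nonempty:
  "(\<And>j. j \<in> J \<Longrightarrow> a j \<le> d j) \<Longrightarrow> schedules (contained_jobs J a d k l) a d \<noteq> {}"
  by (auto simp: schedules_def contained_jobs_def PiE_eq_empty_iff)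

end

theory Submission
  imports Defs
begin

text \<open>
  Let \<open>z\<close> be a slot of maximal load in an optimal schedule. By convexity of \<open>C\<close>, moving every job
  that can be served at \<open>z\<close> to \<open>z\<close> does not decrease the cost. The remaining jobs
  end before \<open>z\<close> or start after \<open>z\<close>, so the cost splits into the three summands on the
  right-hand side. Conversely, a clique at \<open>z\<close> together with optimal schedules to the left and to
  the right of \<open>z\<close> is a feasible schedule.
\<close>

text \<open>Chord slopes of a convex function increase from left to right, and the interval from
  \<open>p\<close> to \<open>q\<close> lies to the left of the one from \<open>r\<close> to
  \<open>s\<close>. The form multiplied by \<open>q - p\<close> also covers \<open>p = q\<close>,
  where the left chord has no slope.\<close>

lemma convex_on_increment_le:
  fixes f :: "real \<Rightarrow> real"
  assumes f: "convex_on S f" and S: "p \<in> S" "q \<in> S" "r \<in> S" "s \<in> S"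
    and ord: "p \<le> q" "q \<le> r" "r < s"
  shows "f q - f p \<le> (q - p) * ((f s - f r) / (s - r))"
proof (cases "p = q")
  case False
  then have pq: "p < q" using ord by simp
  have slopes: "(f v - f u) / (v - u) \<le> (f w - f v) / (w - v)"
    if "u < v" "v < w" "u \<in> S" "w \<in> S" for u v w
  proof -
    have "(f u - f v) / (u - v) \<le> (f v - f w) / (v - w)"
      using convex_on_slope_le[OF f that(3,4,1,2)] by linarith
    then show ?thesis by (metis minus_diff_eq minus_divide_divide)
  qed
  have "(f q - f p) / (q - p) \<le> (f s - f r) / (s - r)"
  \<comment> \<open>If there is a gap between the two intervals, its chord links their slopes;
    otherwise they are adjacent.\<close>
  proof (cases "q = r")
    case True
    then show ?thesis using slopes pq ord S by simp
  next
    case False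
    then have "q < r" using ord by simp
    then show ?thesis using slopes[of p q r] slopes[of q r s] pq ord S by simp
  qed
  then show ?thesis using pq by (simp add: pos_divide_le_eq mult.commute)
qed simp

text \<open>Here \<open>x\<close> stands for the largest load, \<open>E t\<close> for another load
  and \<open>m t\<close> for the part of it that is moved onto \<open>x\<close>. Each removal
  happens at a level of at most \<open>x\<close>, so it saves at most \<open>m t\<close> times the
  chord slope from \<open>x\<close> to \<open>x + M\<close>, where \<open>M\<close> is the total
  moved. These bounds add up to exactly the increase at \<open>x\<close>.\<close>

lemma convex_on_sum_concentrate_le:
  fixes f :: "real \<Rightarrow> real" and E m :: "'a \<Rightarrow> real"
  assumes f: "convex_on {0..} f" and fin: "finite A"
    and m: "\<And>t. t \<in> A \<Longrightarrow> 0 \<le> m t" "\<And>t. t \<in> A \<Longrightarrow> m t \<le> E t"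
    and E: "\<And>t. t \<in> A \<Longrightarrow> E t \<le> x" "0 \<le> x"
  shows "f x + (\<Sum>t\<in>A. f (E t)) \<le> f (x + (\<Sum>t\<in>A. m t)) + (\<Sum>t\<in>A. f (E t - m t))"
proof (cases "(\<Sum>t\<in>A. m t) = 0")
  case True
  then have "\<forall>t\<in>A. m t = 0" using m fin by (simp add: sum_nonneg_eq_0_iff)
  then show ?thesis by simp
next
  case False
  define M where "M = (\<Sum>t\<in>A. m t)"
  have M: "M > 0" using False m by (simp add: M_def less_le sum_nonneg)
  have "(\<Sum>t\<in>A. f (E t) - f (E t - m t)) \<le> (\<Sum>t\<in>A. m t * ((f (x + M) - f x) / M))"
  proof (rule sum_mono)
    fix t assume t: "t \<in> A"
    show "f (E t) - f (E t - m t) \<le> m t * ((f (x + M) - f x) / M)"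
      using convex_on_increment_le[OF f, of "E t - m t" "E t" x "x + M"] m[OF t] E(1)[OF t] E(2) M
      by simp
  qed
  also have "\<dots> = f (x + M) - f x"
    unfolding sum_distrib_right[symmetric] M_def[symmetric] using M by simp
  finally show ?thesis by (simp add: sum_subtractf M_def)
qed

lemma schedule_cost_cong:
  assumes "\<And>j. j \<in> I \<Longrightarrow> s j = s' j"
  shows "schedule_cost C I e k l s = schedule_cost C I e k l s'"
proof -
  have "{j \<in> I. s j = t} = {j \<in> I. s' j = t}" for t using assms by auto
  then show ?thesis by (simp add: schedule_cost_def)
qed

text \<open>Elements of \<open>schedules\<close> are extensional. Restricting \<open>s\<close> to
  the contained jobs produces one at equal cost, so schedules built by case distinction can be
  compared with the maximum directly.\<close>

lemma schedule_cost_le_max_cost: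
  assumes "finite J" and "\<And>j. j \<in> contained_jobs J a d k l \<Longrightarrow> s j \<in> {a j..d j}"
  shows "schedule_cost C (contained_jobs J a d k l) e k l s \<le> max_cost C J a d e k l"
proof (cases "k > l")
  case True
  then show ?thesis by (simp add: schedule_cost_def max_cost_def)
next
  case False
  let ?I = "contained_jobs J a d k l"
  have "restrict s ?I \<in> schedules ?I a d"
    using assms(2) by (auto simp: schedules_def)
  then have "schedule_cost C ?I e k l (restrict s ?I) \<le> max_cost C J a d e k l"
    using False finite_schedules[OF assms(1)] by (simp add: max_cost_def)
  moreover have "schedule_cost C ?I e k l (restrict s ?I) = schedule_cost C ?I e k l s"
    by (rule schedule_cost_cong) simp
  ultimately show ?thesis by simp
qed

lemma max_cost_attained:
  assumes "finite J" and "\<And>j. j \<in> J \<Longrightarrow> a j \<le> d j"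
  obtains s where "\<And>j. j \<in> contained_jobs J a d k l \<Longrightarrow> s j \<in> {a j..d j}"
    and "max_cost C J a d e k l = schedule_cost C (contained_jobs J a d k l) e k l s"
proof (cases "k > l")
  case True
  \<comment> \<open>There are no slots, hence the cost is an empty sum; arrival times serve as an
    arbitrary feasible choice.\<close>
  show ?thesis
  proof (rule that[of a])
    show "a j \<in> {a j..d j}" if "j \<in> contained_jobs J a d k l" for j
      using assms(2) that by (simp add: contained_jobs_def)
  qed (use True in \<open>simp add: schedule_cost_def max_cost_def\<close>)
next
  case False
  let ?I = "contained_jobs J a d k l"
  have "max_cost C J a d e k l \<in> schedule_cost C ?I e k l ` schedules ?I a d"
    unfolding max_cost_def
    using False finite_schedules[OF assms(1)] schedules_nonempty[OF assms(2)] by (simp add: Max_in)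
  then obtain s where "s \<in> schedules ?I a d"
    and "max_cost C J a d e k l = schedule_cost C ?I e k l s" by blast
  then show ?thesis using that[of s] by (simp add: schedules_def PiE_iff)
qed

text \<open>Once the whole clique sits at \<open>z\<close>, every other contained job ends before
  \<open>z\<close> or starts after it, so the two sides share no jobs. The assumption
  \<open>1 \<le> z\<close> makes \<open>z - 1\<close> the true predecessor.\<close>

lemma schedule_cost_split:
  assumes z: "z \<in> {k..l}" "1 \<le> z"
    and s: "\<And>j. j \<in> contained_jobs J a d k l \<Longrightarrow> s j \<in> {a j..d j}"
    and clique: "\<And>j. j \<in> local_clique J a d k l z \<Longrightarrow> s j = z"
  shows "schedule_cost C (contained_jobs J a d k l) e k l s =
    C (\<Sum>j\<in>local_clique J a d k l z. e j)
      + schedule_cost C (contained_jobs J a d k (z - 1)) e k (z - 1) s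
      + schedule_cost C (contained_jobs J a d (z + 1) l) e (z + 1) l s"
proof -
  let ?I = "contained_jobs J a d"
  let ?h = "\<lambda>t. C (\<Sum>j\<in>{j \<in> ?I k l. s j = t}. e j)"
  have slots: "{k..l} = insert z ({k..z - 1} \<union> {z + 1..l})" using z by auto
  have "(\<Sum>t=k..l. ?h t) = ?h z + (\<Sum>t=k..z - 1. ?h t) + (\<Sum>t=z + 1..l. ?h t)"
    unfolding slots using z by (subst sum.insert) (auto simp: sum.union_disjoint add.assoc)
  moreover have "{j \<in> ?I k l. s j = z} = local_clique J a d k l z"
  proof (intro equalityI subsetI)
    show "j \<in> local_clique J a d k l z" if "j \<in> {j \<in> ?I k l. s j = z}" for j
      using s[of j] that by (simp add: local_clique_def)
    show "j \<in> {j \<in> ?I k l. s j = z}" if "j \<in> local_clique J a d k l z" for j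
      using clique[OF that] that by (simp add: local_clique_def)
  qed
  moreover have "{j \<in> ?I k l. s j = t} = {j \<in> ?I k (z - 1). s j = t}" if "t \<in> {k..z - 1}" for t
  proof -
    \<comment> \<open>A job served before \<open>z\<close> with deadline at least \<open>z\<close>
      would belong to the clique and thus be served at \<open>z\<close>.\<close>
    have "j \<in> ?I k (z - 1)" if "j \<in> ?I k l" "s j = t" for j
    proof (rule ccontr)
      assume "j \<notin> ?I k (z - 1)"
      with that z(2) have "\<not> d j < z" by (auto simp: contained_jobs_def)
      then have "j \<in> local_clique J a d k l z"
        using s[OF that(1)] that \<open>t \<in> {k..z - 1}\<close> by (auto simp: local_clique_def)
      then show False using clique[of j] that(2) \<open>t \<in> {k..z - 1}\<close> z(2) by auto
    qed
    moreover have "?I k (z - 1) \<subseteq> ?I k l" using z by (auto simp: contained_jobs_def)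
    ultimately show ?thesis by blast
  qed
  moreover have "{j \<in> ?I k l. s j = t} = {j \<in> ?I (z + 1) l. s j = t}" if "t \<in> {z + 1..l}" for t
  proof -
    have "j \<in> ?I (z + 1) l" if "j \<in> ?I k l" "s j = t" for j
    proof (rule ccontr)
      assume "j \<notin> ?I (z + 1) l"
      with that z(2) have "\<not> z < a j" by (auto simp: contained_jobs_def)
      then have "j \<in> local_clique J a d k l z"
        using s[OF that(1)] that \<open>t \<in> {z + 1..l}\<close> by (auto simp: local_clique_def)
      then show False using clique[of j] that(2) \<open>t \<in> {z + 1..l}\<close> z(2) by auto
    qed
    moreover have "?I (z + 1) l \<subseteq> ?I k l" using z by (auto simp: contained_jobs_def)
    ultimately show ?thesis by blast
  qed
  ultimately show ?thesis by (simp add: schedule_cost_def)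
qed

text \<open>The loads change as in \<open>convex_on_sum_concentrate_le\<close>, with
  \<open>m t\<close> the energy of the jobs of \<open>K\<close> at slot \<open>t\<close>. The set
  \<open>K\<close> is arbitrary: feasibility of the new schedule is a separate matter.\<close>

lemma schedule_cost_move_clique:
  assumes C: "convex_on {0..} C" and fin: "finite I" and e: "\<And>j. j \<in> I \<Longrightarrow> 0 \<le> e j"
    and z: "z \<in> {k..l}"
    and maximal: "\<And>t. t \<in> {k..l} \<Longrightarrow>
      (\<Sum>j\<in>{j \<in> I. s j = t}. e j) \<le> (\<Sum>j\<in>{j \<in> I. s j = z}. e j)"
    and s: "\<And>j. j \<in> I \<Longrightarrow> s j \<in> {k..l}"
  shows "schedule_cost C I e k l s \<le>
    schedule_cost C I e k l (\<lambda>j. if j \<in> K then z else s j)"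
proof -
  let ?s' = "\<lambda>j. if j \<in> K then z else s j"
  define E where "E t = (\<Sum>j\<in>{j \<in> I. s j = t}. e j)" for t
  define m where "m t = (\<Sum>j\<in>{j \<in> I \<inter> K. s j = t}. e j)" for t
  define A where "A = {k..l} - {z}"
  have m: "0 \<le> m t" "m t \<le> E t" "0 \<le> E t" for t
    unfolding m_def E_def using fin e by (auto intro!: sum_nonneg sum_mono2)
  have off: "(\<Sum>j\<in>{j \<in> I. ?s' j = t}. e j) = E t - m t" if "t \<in> A" for t
  proof -
    have "{j \<in> I. ?s' j = t} = {j \<in> I. s j = t} - {j \<in> I \<inter> K. s j = t}"
      using that by (auto simp: A_def)
    then show ?thesis unfolding E_def m_def using fin by (simp only:) (subst sum_diff; auto)
  qed
  have at: "(\<Sum>j\<in>{j \<in> I. ?s' j = z}. e j) = E z + (\<Sum>t\<in>A. m t)"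
  proof -
    \<comment> \<open>Grouped by their old slots, the jobs that actually move account for all the
      \<open>m t\<close>.\<close>
    have "(\<Sum>t\<in>A. m t) = (\<Sum>j\<in>{j \<in> I \<inter> K. s j \<noteq> z}. e j)"
    proof -
      have "(\<Sum>t\<in>A. m t) = (\<Sum>t\<in>A. \<Sum>j\<in>{j \<in> {j \<in> I \<inter> K. s j \<noteq> z}. s j = t}. e j)"
        unfolding m_def by (intro sum.cong) (auto simp: A_def)
      also have "\<dots> = (\<Sum>j\<in>{j \<in> I \<inter> K. s j \<noteq> z}. e j)"
        using fin s by (intro sum.group) (auto simp: A_def)
      finally show ?thesis .
    qed
    moreover have "{j \<in> I. ?s' j = z} = {j \<in> I. s j = z} \<union> {j \<in> I \<inter> K. s j \<noteq> z}" by auto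
    ultimately show ?thesis unfolding E_def using fin by (simp only:) (subst sum.union_disjoint; auto)
  qed
  have split: "(\<Sum>t=k..l. h t) = h z + (\<Sum>t\<in>A. h t)" for h :: "nat \<Rightarrow> real"
    using z by (simp add: A_def sum.remove)
  have "schedule_cost C I e k l s = C (E z) + (\<Sum>t\<in>A. C (E t))"
    by (simp add: schedule_cost_def split E_def)
  also have "\<dots> \<le> C (E z + (\<Sum>t\<in>A. m t)) + (\<Sum>t\<in>A. C (E t - m t))"
    using m maximal by (intro convex_on_sum_concentrate_le[OF C]) (auto simp: A_def E_def)
  also have "\<dots> = schedule_cost C I e k l ?s'"
    unfolding schedule_cost_def split at using off by simp
  finally show ?thesis .
qed

theorem theorem1:
  fixes T n :: nat
    and a d :: "nat \<Rightarrow> nat"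
    and e :: "nat \<Rightarrow> real"
    and C :: "real \<Rightarrow> real"
    and k l :: nat
  assumes "n \<ge> 1"
    and "\<And>j. j \<in> {1..n} \<Longrightarrow> a j \<in> {1..T} \<and> d j \<in> {1..T} \<and> a j \<le> d j"
    and "\<And>j. j \<in> {1..n} \<Longrightarrow> e j > 0"
    and "C \<in> {0..} \<rightarrow> {0..}"
    and "mono_on {0..} C"
    and "convex_on {0..} C"
    and "k \<in> {1..T}" and "l \<in> {1..T}" and "k \<le> l"
  shows "max_cost C {1..n} a d e k l =
    Max ((\<lambda>z. C (\<Sum>j\<in>local_clique {1..n} a d k l z. e j)
              + max_cost C {1..n} a d e k (z - 1)
              + max_cost C {1..n} a d e (z + 1) l) ` {k..l})"
proof -
  let ?J = "{1..n}"
  let ?I = "contained_jobs ?J a d"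
  let ?K = "local_clique ?J a d k l"
  let ?R = "\<lambda>z. C (\<Sum>j\<in>?K z. e j) + max_cost C ?J a d e k (z - 1) + max_cost C ?J a d e (z + 1) l"
  have J: "finite ?J" and ad: "\<And>j. j \<in> ?J \<Longrightarrow> a j \<le> d j" using assms(2) by auto
  have sub: "?I k (z - 1) \<subseteq> ?I k l" "?I (z + 1) l \<subseteq> ?I k l" if "z \<in> {k..l}" for z
    using that by (auto simp: contained_jobs_def)
  have ge: "?R z \<le> max_cost C ?J a d e k l" if z: "z \<in> {k..l}" for z
  proof -
    obtain p where p: "\<And>j. j \<in> ?I k (z - 1) \<Longrightarrow> p j \<in> {a j..d j}"
      "max_cost C ?J a d e k (z - 1) = schedule_cost C (?I k (z - 1)) e k (z - 1) p"
      using max_cost_attained[where a=a and d=d, OF J ad] by blast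
    obtain q where q: "\<And>j. j \<in> ?I (z + 1) l \<Longrightarrow> q j \<in> {a j..d j}"
      "max_cost C ?J a d e (z + 1) l = schedule_cost C (?I (z + 1) l) e (z + 1) l q"
      using max_cost_attained[where a=a and d=d, OF J ad] by blast
    have z1: "1 \<le> z" using z assms(7) by simp
    \<comment> \<open>Outside the clique, the deadline alone tells on which side of \<open>z\<close>
      a job lies.\<close>
    define s where "s j = (if j \<in> ?K z then z else if d j < z then p j else q j)" for j
    have notK: "j \<notin> ?K z \<and> d j < z" if "j \<in> ?I k (z - 1)" for j
      using that z1 by (auto simp: contained_jobs_def local_clique_def)
    have notK': "j \<notin> ?K z \<and> \<not> d j < z" if "j \<in> ?I (z + 1) l" for j
      using that ad[of j] by (auto simp: contained_jobs_def local_clique_def)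
    have s: "s j \<in> {a j..d j}" if j: "j \<in> ?I k l" for j
    proof -
      consider "j \<in> ?K z" | "j \<in> ?I k (z - 1)" | "j \<in> ?I (z + 1) l"
        using j by (fastforce simp: contained_jobs_def local_clique_def)
      then show ?thesis
      proof cases
        case 1
        then show ?thesis by (auto simp: s_def local_clique_def)
      next
        case 2
        then show ?thesis using notK p(1) by (simp add: s_def)
      next
        case 3
        then show ?thesis using notK' q(1) by (simp add: s_def)
      qed
    qed
    have "schedule_cost C (?I k (z - 1)) e k (z - 1) s
        = schedule_cost C (?I k (z - 1)) e k (z - 1) p"
      by (rule schedule_cost_cong) (use notK in \<open>simp add: s_def\<close>)
    moreover have "schedule_cost C (?I (z + 1) l) e (z + 1) l s
        = schedule_cost C (?I (z + 1) l) e (z + 1) l q"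
      by (rule schedule_cost_cong) (use notK' in \<open>simp add: s_def\<close>)
    moreover have "schedule_cost C (?I k l) e k l s = C (\<Sum>j\<in>?K z. e j)
        + schedule_cost C (?I k (z - 1)) e k (z - 1) s
        + schedule_cost C (?I (z + 1) l) e (z + 1) l s"
      by (rule schedule_cost_split[OF z z1 s]) (simp_all add: s_def)
    moreover have "schedule_cost C (?I k l) e k l s \<le> max_cost C ?J a d e k l"
      by (rule schedule_cost_le_max_cost[OF J s])
    ultimately show ?thesis by (simp only: p(2) q(2))
  qed
  have le: "\<exists>z\<in>{k..l}. max_cost C ?J a d e k l \<le> ?R z"
  proof -
    obtain s where s: "\<And>j. j \<in> ?I k l \<Longrightarrow> s j \<in> {a j..d j}"
      "max_cost C ?J a d e k l = schedule_cost C (?I k l) e k l s"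
      using max_cost_attained[where a=a and d=d, OF J ad] by blast
    define E where "E t = (\<Sum>j\<in>{j \<in> ?I k l. s j = t}. e j)" for t
    \<comment> \<open>The slot \<open>z\<close> must carry the largest load of the optimal schedule
      \<open>s\<close>, since only then is moving energy to it known not to lower the cost.\<close>
    have "Max (E ` {k..l}) \<in> E ` {k..l}" using assms(9) by (intro Max_in) auto
    then obtain z where z: "z \<in> {k..l}" "Max (E ` {k..l}) = E z" by auto
    have maximal: "E t \<le> E z" if "t \<in> {k..l}" for t
      using that z(2)[symmetric] by simp
    have z1: "1 \<le> z" using z assms(7) by simp
    \<comment> \<open>Moving exactly the clique keeps the schedule feasible, as its jobs are those
      whose intervals contain \<open>z\<close>.\<close>
    define s' where "s' j = (if j \<in> ?K z then z else s j)" for j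
    have s': "s' j \<in> {a j..d j}" if "j \<in> ?I k l" for j
      using s(1)[OF that] by (auto simp: s'_def local_clique_def)
    have "schedule_cost C (?I k l) e k l s \<le> schedule_cost C (?I k l) e k l s'"
      unfolding s'_def
    proof (rule schedule_cost_move_clique[OF assms(6) _ _ z(1)])
      show "finite (?I k l)" by (simp add: contained_jobs_def)
      show "0 \<le> e j" if "j \<in> ?I k l" for j
        using that assms(3)[of j] by (simp add: contained_jobs_def)
      show "(\<Sum>j\<in>{j \<in> ?I k l. s j = t}. e j) \<le> (\<Sum>j\<in>{j \<in> ?I k l. s j = z}. e j)"
        if "t \<in> {k..l}" for t using maximal[OF that] by (simp add: E_def)
      show "s j \<in> {k..l}" if "j \<in> ?I k l" for j
        using s(1)[OF that] that by (auto simp: contained_jobs_def)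
    qed
    also have "\<dots> = C (\<Sum>j\<in>?K z. e j) + schedule_cost C (?I k (z - 1)) e k (z - 1) s'
        + schedule_cost C (?I (z + 1) l) e (z + 1) l s'"
      by (rule schedule_cost_split[OF z(1) z1 s']) (simp_all add: s'_def)
    \<comment> \<open>On either side \<open>s'\<close> is feasible for the smaller problem, though
      perhaps not optimal there.\<close>
    also have "\<dots> \<le> ?R z"
      using sub[OF z(1)] s' by (intro add_mono order_refl schedule_cost_le_max_cost[OF J]) blast+
    finally show ?thesis using s(2) z(1) by auto
  qed
  show ?thesis
  proof (rule antisym)
    show "max_cost C ?J a d e k l \<le> Max (?R ` {k..l})"
    proof -
      obtain z where z: "z \<in> {k..l}" and "max_cost C ?J a d e k l \<le> ?R z" using le by blast
      note this(2)
      also have "?R z \<le> Max (?R ` {k..l})" by (intro Max_ge imageI z) simp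
      finally show ?thesis .
    qed
    show "Max (?R ` {k..l}) \<le> max_cost C ?J a d e k l"
      using ge assms(9) by (subst Max_le_iff) auto
  qed
qed

end
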